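(* Let $n,m\ge 1$, $d_f\ge 1$ and $d_v\ge 2$ be integers, let $(x_1,y_1),\dots,(x_m,y_m)\in\mathbb{R}^n\times\mathbb{R}^n$ be given data, and set $p=\binom{n+d_v}{n}$, $r=\binom{n+d_f}{n}$. Let $\varphi=(\varphi_1,\dots,\varphi_p)$ and $\zeta=(\zeta_1,\dots,\zeta_r)$ be vectors of polynomials whose entries are bases of $\mathbb{R}[x]_{d_v}$ and $\mathbb{R}[x]_{d_f}$, respectively. For every invertible $\Lambda\in\mathbb{R}^{n\times n}$, every $\mu\in\mathbb{R}^n$ and all real numbers $\alpha,\beta,\varepsilon_1,\varepsilon_2,\varepsilon_3,\varepsilon_4>0$, consider the optimization problem $$ \begin{aligned} \min_{F\in\mathbb{R}^{n\times r},\ u\in\mathbb{R}^p,\ b,c\in\mathbb{R}}\quad & \Big(\sum_{i=1}^m\|F\zeta(x_i)-y_i\|^2\Big)^{1/2}+\varepsilon_1|c-1|+\varepsilon_3|b|+\varepsilon_2\|F\|_{\ell^1}+\varepsilon_4\|u\|_{\ell^1}\\ \text{subject to}\quad & b-c\,\langle u,\varphi(x)\rangle-\alpha\,\langle F\zeta(x),\nabla\varphi(x)^\top u\rangle\in\Sigma[x]_{d_v+d_f-1},\\ & \langle u,\varphi(x)\rangle-\|\Lambda x+\mu\|^2\in\Sigma[x]_{d_v},\\ & 0\le c\le 1,\\ & |b|\le\beta c. \end{aligned} $$ Then: (a) The problem is feasible and has an optimal solution (that is, the minimum is attained). (b) If $F\in\mathbb{R}^{n\times r}$ is admissible, i.e.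 there exist $u\in\mathbb{R}^p$ and $b,c\in\mathbb{R}$ such that $(F,u,b,c)$ satisfies all the constraints, then the ODE $\dot x=F\zeta(x)$ has bounded solutions: for every initial condition $x_0\in\mathbb{R}^n$, the solution $x(t)$ of $\dot x(t)=F\zeta(x(t))$, $x(0)=x_0$, remains bounded for all times $t\ge 0$.
   Context: $\mathbb{R}[x]_d$ denotes the vector space of real polynomials in $x=(x_1,\dots,x_n)$ of degree at most $d$. The set of sum-of-squares polynomials of degree at most $d$ is $$\Sigma[x]_d=\{\sigma\in\mathbb{R}[x]_d:\ \exists k\in\mathbb{N},\ \rho_1,\dots,\rho_k\in\mathbb{R}[x]_{\lfloor d/2\rfloor}\ \text{such that}\ \sigma=\rho_1^2+\cdots+\rho_k^2\}.$$ A constraint such as $g(x)\in\Sigma[x]_d$ means that the polynomial $g$ belongs to $\Sigma[x]_d$. $\langle\cdot,\cdot\rangle$ and $\|\cdot\|$ are the Euclidean inner product and norm; $\|\cdot\|_{\ell^1}$ is the sum of absolute values of the entries of a vector or matrix. $\nabla\varphi(x)\in\mathbb{R}^{p\times n}$ is the Jacobian matrix with entries $(\nabla\varphi)_{ij}=\partial\varphi_i/\partial x_j$, so that $\nabla\langle u,\varphi\rangle=\nabla\varphi^\top u$. In the data, $x_i$ and $y_i$ are vectors in $\mathbb{R}^n$ (not coordinates of $x$). *)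

theory Defs
  imports "HOL-Analysis.Analysis"
begin

text \<open>
  Real polynomials in \<open>n = CARD('n)\<close> variables are identified with the polynomial functions they
  induce on \<open>real ^ 'n\<close>, which loses nothing over the infinite field of reals. A multi-index is a
  function \<open>k :: 'n \<Rightarrow> nat\<close>; there are finitely many of total degree at most \<open>d\<close>, so the sum
  below is an ordinary finite sum.
\<close>

lemma finite_multi_indices: "finite {k :: 'n::finite \<Rightarrow> nat. (\<Sum>i\<in>UNIV. k i) \<le> d}"
proof (rule finite_subset)
  show "{k :: 'n \<Rightarrow> nat. (\<Sum>i\<in>UNIV. k i) \<le> d} \<subseteq> (\<Pi>\<^sub>E i\<in>UNIV. {..d})"
  proof
    fix k :: "'n \<Rightarrow> nat"
    assume "k \<in> {k. (\<Sum>i\<in>UNIV. k i) \<le> d}"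
    moreover have "k i \<le> (\<Sum>i\<in>UNIV. k i)" for i
      by (rule member_le_sum) auto
    ultimately show "k \<in> (\<Pi>\<^sub>E i\<in>UNIV. {..d})"
      by (auto intro: order_trans)
  qed
  show "finite (\<Pi>\<^sub>E i\<in>(UNIV :: 'n set). {..d})"
    by (rule finite_PiE) auto
qed

definition polys :: "nat \<Rightarrow> (real ^ 'n \<Rightarrow> real) set" where
  "polys d = {f. \<exists>a :: ('n \<Rightarrow> nat) \<Rightarrow> real.
      f = (\<lambda>x. \<Sum>k | (\<Sum>i\<in>UNIV. k i) \<le> d. a k * (\<Prod>i\<in>UNIV. (x $ i) ^ k i))}"

definition sos :: "nat \<Rightarrow> (real ^ 'n \<Rightarrow> real) set" where
  "sos d = {\<sigma> \<in> polys d. \<exists>(k :: nat) \<rho>.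
      (\<forall>j\<in>{1..k}. \<rho> j \<in> polys (d div 2)) \<and> \<sigma> = (\<lambda>x. \<Sum>j=1..k. (\<rho> j x)\<^sup>2)}"

text \<open>
  A vector of polynomials is a map \<open>B :: real ^ 'n \<Rightarrow> real ^ 'p\<close> with entries \<open>\<lambda>x. B x $ i\<close>, and
  \<open>\<lambda>x. u \<bullet> B x\<close> is the linear combination of the entries with coefficients \<open>u\<close>. The entries form
  a basis if they are linearly independent (as an indexed family) and their span is \<open>polys d\<close>.
\<close>

definition poly_basis :: "nat \<Rightarrow> (real ^ 'n \<Rightarrow> real ^ 'p) \<Rightarrow> bool" where
  "poly_basis d B \<longleftrightarrow>
     (\<forall>u. (\<lambda>x. u \<bullet> B x) = (\<lambda>x. 0) \<longrightarrow> u = 0) \<and>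
     range (\<lambda>u x. u \<bullet> B x) = polys d"

definition jacobian :: "(real ^ 'n \<Rightarrow> real ^ 'p) \<Rightarrow> real ^ 'n \<Rightarrow> real ^ 'n ^ 'p" where
  "jacobian g x = matrix (frechet_derivative g (at x))"

lemma jacobian_entry:
  fixes g :: "real ^ 'n \<Rightarrow> real ^ 'p"
  assumes "g differentiable (at x)"
  shows "((\<lambda>s. g (x + s *\<^sub>R axis j 1) $ i) has_real_derivative jacobian g x $ i $ j) (at 0)"
proof -
  let ?D = "frechet_derivative g (at x)"
  have D: "(g has_derivative ?D) (at x)"
    using assms frechet_derivative_works by blast
  have "((\<lambda>s::real. x + s *\<^sub>R axis j 1) has_derivative (\<lambda>s. s *\<^sub>R axis j 1)) (at 0)"
    by (auto intro!: derivative_eq_intros)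
  then have "((\<lambda>s. g (x + s *\<^sub>R axis j 1)) has_derivative (\<lambda>s. ?D (s *\<^sub>R axis j 1))) (at 0)"
    using has_derivative_compose[of "\<lambda>s::real. x + s *\<^sub>R axis j 1" _ 0 UNIV g ?D] D by simp
  then have "((\<lambda>s. g (x + s *\<^sub>R axis j 1) $ i) has_derivative
      (\<lambda>s. ?D (s *\<^sub>R axis j 1) $ i)) (at 0)"
    by (rule bounded_linear.has_derivative[OF bounded_linear_vec_nth])
  moreover have "?D (s *\<^sub>R axis j 1) $ i = jacobian g x $ i $ j * s" for s
    using linear_scale[OF has_derivative_linear[OF D]]
    by (simp add: jacobian_def matrix_def)
  ultimately show ?thesis
    by (simp add: has_field_derivative_def)
qed

definition l1_vec :: "real ^ 'p \<Rightarrow> real" where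
  "l1_vec u = (\<Sum>i\<in>UNIV. \<bar>u $ i\<bar>)"

definition l1_mat :: "real ^ 'r ^ 'n \<Rightarrow> real" where
  "l1_mat F = (\<Sum>i\<in>UNIV. \<Sum>j\<in>UNIV. \<bar>F $ i $ j\<bar>)"

definition objective ::
  "nat \<Rightarrow> (nat \<Rightarrow> real ^ 'n) \<Rightarrow> (nat \<Rightarrow> real ^ 'n) \<Rightarrow> (real ^ 'n \<Rightarrow> real ^ 'r) \<Rightarrow>
   real \<Rightarrow> real \<Rightarrow> real \<Rightarrow> real \<Rightarrow>
   (real ^ 'r ^ 'n) \<times> (real ^ 'p) \<times> real \<times> real \<Rightarrow> real" where
  "objective m xs ys \<zeta> \<epsilon>\<^sub>1 \<epsilon>\<^sub>2 \<epsilon>\<^sub>3 \<epsilon>\<^sub>4 = (\<lambda>(F, u, b, c).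
     sqrt (\<Sum>i=1..m. (norm (F *v \<zeta> (xs i) - ys i))\<^sup>2)
     + \<epsilon>\<^sub>1 * \<bar>c - 1\<bar> + \<epsilon>\<^sub>3 * \<bar>b\<bar> + \<epsilon>\<^sub>2 * l1_mat F + \<epsilon>\<^sub>4 * l1_vec u)"

definition feasible ::
  "nat \<Rightarrow> nat \<Rightarrow> (real ^ 'n \<Rightarrow> real ^ 'p) \<Rightarrow> (real ^ 'n \<Rightarrow> real ^ 'r) \<Rightarrow>
   real ^ 'n ^ 'n \<Rightarrow> real ^ 'n \<Rightarrow> real \<Rightarrow> real \<Rightarrow>
   (real ^ 'r ^ 'n) \<times> (real ^ 'p) \<times> real \<times> real \<Rightarrow> bool" where
  "feasible d\<^sub>v d\<^sub>f \<phi> \<zeta> \<Lambda> \<mu> \<alpha> \<beta> = (\<lambda>(F, u, b, c).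
     (\<lambda>x. b - c * (u \<bullet> \<phi> x) - \<alpha> * ((F *v \<zeta> x) \<bullet> (transpose (jacobian \<phi> x) *v u)))
       \<in> sos (d\<^sub>v + d\<^sub>f - 1) \<and>
     (\<lambda>x. u \<bullet> \<phi> x - (norm (\<Lambda> *v x + \<mu>))\<^sup>2) \<in> sos d\<^sub>v \<and>
     0 \<le> c \<and> c \<le> 1 \<and> \<bar>b\<bar> \<le> \<beta> * c)"

definition solves_ivp ::
  "(real ^ 'n \<Rightarrow> real ^ 'n) \<Rightarrow> real ^ 'n \<Rightarrow> real set \<Rightarrow> (real \<Rightarrow> real ^ 'n) \<Rightarrow> bool" where
  "solves_ivp f x0 I X \<longleftrightarrow>
     X 0 = x0 \<and> (\<forall>t\<in>I. (X has_vector_derivative f (X t)) (at t within I))"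

text \<open>
  ``The solution'' with initial value \<open>x0\<close> remains bounded for all \<open>t \<ge> 0\<close>: there is a bounded
  solution on the whole half-line, and it is the solution, in that every solution on an interval
  \<open>{0..<\<tau>}\<close> is a restriction of it (so none escapes in finite time).
\<close>

definition has_bounded_solutions :: "(real ^ 'n \<Rightarrow> real ^ 'n) \<Rightarrow> bool" where
  "has_bounded_solutions f \<longleftrightarrow>
     (\<forall>x0. \<exists>X. solves_ivp f x0 {0..} X \<and> bounded (X ` {0..}) \<and>
        (\<forall>\<tau> Y. \<tau> > 0 \<longrightarrow> solves_ivp f x0 {0..<\<tau>} Y \<longrightarrow> (\<forall>t\<in>{0..<\<tau>}. Y t = X t)))"

end

theory Submission
  imports Defs
begin

text \<open>
  A minimum exists because the problem is a continuous minimization over a compact set. The zero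
  field with the Lyapunov function \<open>\<parallel>\<Lambda> x + \<mu>\<parallel>\<^sup>2\<close> and \<open>b = c = 0\<close> is feasible. The penalties on
  \<open>F\<close> and \<open>u\<close>, together with \<open>0 \<le> c \<le> 1\<close> and \<open>\<bar>b\<bar> \<le> \<beta> c\<close>, make each sublevel set of the objective
  bounded. The point that needs work is that the feasible set is closed, which reduces to the
  statement that a pointwise limit of sums of squares from \<open>sos d\<close> lies in \<open>sos d\<close>
  (\<open>sos_pointwise_closed\<close>). Writing the squared polynomials in a basis \<open>B\<close> turns sums of squares
  into quadratic forms \<open>B x \<bullet> (Q *v B x)\<close>. The Gram matrices \<open>Q\<close> are the nonnegative multiples of
  points of a compact convex set \<open>H\<close>, and no point of \<open>H\<close> represents the zero polynomial. Along a
  convergent sequence of sums of squares one can therefore pass to a convergent subsequence in \<open>H\<close>,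
  and then the multiples converge too.

  Admissible fields have bounded solutions because \<open>V x = u \<bullet> \<phi> x\<close> is a Lyapunov function. A sum of
  squares is nonnegative, so the first constraint says that the derivative of \<open>V\<close> along the field is
  at most \<open>(b - c V) / \<alpha> \<le> (c / \<alpha>) (\<beta> - V)\<close>; hence \<open>V\<close> never exceeds the larger of \<open>\<beta>\<close> and its
  initial value along a solution (\<open>lyapunov_bound\<close>). The second constraint says that
  \<open>V x \<ge> \<parallel>\<Lambda> x + \<mu>\<parallel>\<^sup>2\<close>, so sublevel sets of \<open>V\<close> are bounded as \<open>\<Lambda>\<close> is invertible.

  A solution is obtained by changing the field outside a large ball so that it becomes bounded and
  globally Lipschitz (\<open>lipschitz_bounded_ode_exists\<close>, a contraction argument); the Lyapunov bound
  keeps the solution away from the region where the field was changed. This argument is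
  \<open>lyapunov_bounded_solutions\<close>.
\<close>

section \<open>Polynomial functions\<close>

definition monomial :: "('n::finite \<Rightarrow> nat) \<Rightarrow> real ^ 'n \<Rightarrow> real" where
  "monomial k x = (\<Prod>i\<in>UNIV. (x $ i) ^ k i)"

lemma monomial_add: "monomial (\<lambda>i. k i + l i) x = monomial k x * monomial l x"
  by (simp add: monomial_def power_add prod.distrib)

lemma polysI:
  "(\<lambda>x. \<Sum>k | (\<Sum>i\<in>UNIV. k i) \<le> d. a k * monomial k x) \<in> polys d"
  unfolding polys_def monomial_def by blast

lemma polysE:
  assumes "f \<in> polys d"
  obtains a where "f = (\<lambda>x. \<Sum>k | (\<Sum>i\<in>UNIV. k i) \<le> d. a k * monomial k x)"
  using assms unfolding polys_def monomial_def by blast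

lemma polys_add:
  assumes "f \<in> polys d" "g \<in> polys d"
  shows "(\<lambda>x. f x + g x) \<in> polys d"
proof -
  obtain a where f: "f = (\<lambda>x. \<Sum>k | (\<Sum>i\<in>UNIV. k i) \<le> d. a k * monomial k x)"
    using assms(1) by (rule polysE)
  obtain b where g: "g = (\<lambda>x. \<Sum>k | (\<Sum>i\<in>UNIV. k i) \<le> d. b k * monomial k x)"
    using assms(2) by (rule polysE)
  have "(\<lambda>x. f x + g x) = (\<lambda>x. \<Sum>k | (\<Sum>i\<in>UNIV. k i) \<le> d. (a k + b k) * monomial k x)"
    by (simp add: f g sum.distrib distrib_right)
  then show ?thesis
    by (simp only: polysI)
qed

lemma polys_cmult:
  assumes "f \<in> polys d"
  shows "(\<lambda>x. c * f x) \<in> polys d"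
proof -
  obtain a where f: "f = (\<lambda>x. \<Sum>k | (\<Sum>i\<in>UNIV. k i) \<le> d. a k * monomial k x)"
    using assms by (rule polysE)
  have "(\<lambda>x. c * f x) = (\<lambda>x. \<Sum>k | (\<Sum>i\<in>UNIV. k i) \<le> d. (c * a k) * monomial k x)"
    by (simp add: f sum_distrib_left mult.assoc)
  then show ?thesis
    by (simp only: polysI)
qed

lemma polys_zero: "(\<lambda>x. 0) \<in> polys d"
  using polysI[of "\<lambda>_. 0" d] by simp

lemma polys_sum:
  assumes "\<And>i. i \<in> I \<Longrightarrow> f i \<in> polys d"
  shows "(\<lambda>x. \<Sum>i\<in>I. f i x) \<in> polys d"
  using assms by (induction I rule: infinite_finite_induct) (auto simp: polys_zero polys_add)

lemma monomial_in_polys: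
  assumes "(\<Sum>i\<in>UNIV. k i) \<le> d"
  shows "monomial k \<in> polys d"
proof -
  have "(\<Sum>l | (\<Sum>i\<in>UNIV. l i) \<le> d. (if l = k then 1 else 0) * monomial l x) = monomial k x" for x
  proof -
    have "(\<Sum>l | (\<Sum>i\<in>UNIV. l i) \<le> d. (if l = k then 1 else 0) * monomial l x)
        = (\<Sum>l | (\<Sum>i\<in>UNIV. l i) \<le> d. if l = k then monomial l x else 0)"
      by (rule sum.cong) auto
    also have "\<dots> = monomial k x"
      using assms by (simp add: sum.delta[OF finite_multi_indices])
    finally show ?thesis .
  qed
  then have eq: "monomial k = (\<lambda>x. \<Sum>l | (\<Sum>i\<in>UNIV. l i) \<le> d. (if l = k then 1 else 0) * monomial l x)"
    by (intro ext) simp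
  show ?thesis
    by (subst eq) (rule polysI)
qed

lemma polys_mono:
  assumes "d \<le> e"
  shows "polys d \<subseteq> polys e"
proof
  fix f :: "real ^ 'n \<Rightarrow> real"
  assume "f \<in> polys d"
  then obtain a where f: "f = (\<lambda>x. \<Sum>k | (\<Sum>i\<in>UNIV. k i) \<le> d. a k * monomial k x)"
    by (rule polysE)
  show "f \<in> polys e"
    unfolding f using assms
    by (intro polys_sum polys_cmult[of "monomial k" for k] monomial_in_polys) auto
qed

lemma polys_mult:
  assumes "f \<in> polys d" "g \<in> polys e"
  shows "(\<lambda>x. f x * g x) \<in> polys (d + e)"
proof -
  obtain a where f: "f = (\<lambda>x. \<Sum>k | (\<Sum>i\<in>UNIV. k i) \<le> d. a k * monomial k x)"
    using assms(1) by (rule polysE)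
  obtain b where g: "g = (\<lambda>x. \<Sum>l | (\<Sum>i\<in>UNIV. l i) \<le> e. b l * monomial l x)"
    using assms(2) by (rule polysE)
  have "f x * g x = (\<Sum>k | (\<Sum>i\<in>UNIV. k i) \<le> d. \<Sum>l | (\<Sum>i\<in>UNIV. l i) \<le> e.
      (a k * b l) * monomial (\<lambda>i. k i + l i) x)" for x
    by (simp add: f g sum_product monomial_add mult_ac)
  then have eq: "(\<lambda>x. f x * g x) = (\<lambda>x. \<Sum>k | (\<Sum>i\<in>UNIV. k i) \<le> d. \<Sum>l | (\<Sum>i\<in>UNIV. l i) \<le> e.
      (a k * b l) * monomial (\<lambda>i. k i + l i) x)"
    by (intro ext)
  show ?thesis
    unfolding eq
    by (intro polys_sum polys_cmult monomial_in_polys) (auto simp: sum.distrib intro: add_mono)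
qed

lemma polys_const: "(\<lambda>x::real^'n. c) \<in> polys d"
proof -
  have "monomial (\<lambda>i. 0) = (\<lambda>x::real^'n. 1)"
    by (simp add: monomial_def fun_eq_iff)
  moreover have "monomial (\<lambda>i::'n. 0) \<in> polys d"
    by (rule monomial_in_polys) simp
  ultimately show ?thesis
    using polys_cmult[of "\<lambda>x::real^'n. 1" d c] by simp
qed

lemma polys_coord: "(\<lambda>x::real^'n. x $ i) \<in> polys 1"
proof -
  let ?k = "\<lambda>j. if j = i then 1 else 0 :: nat"
  have "monomial ?k x = (\<Prod>j\<in>UNIV. if j = i then x $ j else 1)" for x :: "real ^ 'n"
    unfolding monomial_def by (rule prod.cong) auto
  then have "monomial ?k = (\<lambda>x. x $ i)"
    by (simp add: fun_eq_iff)
  moreover have "monomial ?k \<in> polys 1"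
    by (rule monomial_in_polys) simp
  ultimately show ?thesis
    by simp
qed

text \<open>
  Many properties of functions pass from the constants and the coordinates to sums and products.
  This rule proves them for all polynomial functions without any reference to coefficients.
\<close>

lemma polys_induct [consumes 1, case_names const coord add mult]:
  assumes f: "f \<in> polys d"
    and const: "\<And>c. P (\<lambda>x. c)"
    and coord: "\<And>i. P (\<lambda>x. x $ i)"
    and add: "\<And>f g. P f \<Longrightarrow> P g \<Longrightarrow> P (\<lambda>x. f x + g x)"
    and mult: "\<And>f g. P f \<Longrightarrow> P g \<Longrightarrow> P (\<lambda>x. f x * g x)"
  shows "P f"
proof -
  obtain a where f: "f = (\<lambda>x. \<Sum>k | (\<Sum>i\<in>UNIV. k i) \<le> d. a k * monomial k x)"
    using f by (rule polysE)
  have pow: "P (\<lambda>x. (x $ i) ^ n)" for i n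
    by (induction n) (auto intro: const coord mult)
  have prod: "P (\<lambda>x. \<Prod>i\<in>I. (x $ i) ^ k i)" if "finite I" for I and k :: "'a \<Rightarrow> nat"
    using that by induction (auto intro: const mult pow)
  have "P (\<lambda>x. \<Sum>k\<in>K. a k * monomial k x)" if "finite K" for K
    using that
    by induction (auto intro!: const add mult intro: prod[OF finite] simp: monomial_def[abs_def])
  then show ?thesis
    unfolding f using finite_multi_indices by blast
qed

lemma polys_differentiable:
  assumes "f \<in> polys d"
  shows "f differentiable (at x)"
  using assms
proof (induction rule: polys_induct)
  case (coord i)
  show ?case
    by (intro bounded_linear_imp_differentiable bounded_linear_vec_nth)
qed (simp_all add: differentiable_add differentiable_mult)

text \<open>
  A product of Lipschitz functions need not be Lipschitz, but it is on a set where both factors are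
  bounded. This is why the statement is restricted to balls.
\<close>

lemma polys_lipschitz:
  assumes "f \<in> polys d"
  shows "\<exists>L. L-lipschitz_on (cball 0 R) f"
  using assms
proof (induction rule: polys_induct)
  case (const c)
  show ?case
    using lipschitz_on_constant by blast
next
  case (coord i)
  have "1-lipschitz_on (cball 0 R) (\<lambda>x::real^'a. x $ i)"
    using component_le_norm_cart[of "x - y" i for x y :: "real^'a"]
    by (intro lipschitz_onI) (auto simp: dist_norm)
  then show ?case
    by blast
next
  case (add f g)
  then show ?case
    using lipschitz_on_add by blast
next
  case (mult f g)
  then obtain L M where L: "L-lipschitz_on (cball 0 R) f" and M: "M-lipschitz_on (cball 0 R) g"
    by blast
  have bdd: "\<exists>B. \<forall>x\<in>cball 0 R. \<bar>h x\<bar> \<le> B" if "N-lipschitz_on (cball 0 R) h"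
    for N and h :: "real^'a \<Rightarrow> real"
  proof -
    have "compact (h ` cball 0 R)"
      by (intro compact_continuous_image lipschitz_on_continuous_on[OF that] compact_cball)
    then obtain B where "\<forall>y\<in>h ` cball 0 R. norm y \<le> B"
      using compact_imp_bounded bounded_iff[of "h ` cball 0 R"] by blast
    then show ?thesis
      by (intro exI[of _ B]) simp
  qed
  obtain B where B: "\<And>x. x \<in> cball 0 R \<Longrightarrow> \<bar>f x\<bar> \<le> B"
    using bdd[OF L] by blast
  obtain C where C: "\<And>x. x \<in> cball 0 R \<Longrightarrow> \<bar>g x\<bar> \<le> C"
    using bdd[OF M] by blast
  have "(\<bar>B\<bar> * M + L * \<bar>C\<bar>)-lipschitz_on (cball 0 R) (\<lambda>x. f x * g x)"
  proof (rule lipschitz_onI)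
    fix x y :: "real^'a" assume x: "x \<in> cball 0 R" and y: "y \<in> cball 0 R"
    have "f x * g x - f y * g y = f x * (g x - g y) + (f x - f y) * g y"
      by (simp add: algebra_simps)
    then have "\<bar>f x * g x - f y * g y\<bar> \<le> \<bar>f x\<bar> * \<bar>g x - g y\<bar> + \<bar>f x - f y\<bar> * \<bar>g y\<bar>"
      by (metis abs_mult abs_triangle_ineq)
    also have "\<dots> \<le> \<bar>B\<bar> * (M * dist x y) + (L * dist x y) * \<bar>C\<bar>"
      using lipschitz_onD[OF L x y] lipschitz_onD[OF M x y] B[OF x] C[OF y]
      by (intro add_mono mult_mono) (auto simp: dist_real_def lipschitz_on_nonneg[OF L])
    finally show "dist (f x * g x) (f y * g y) \<le> (\<bar>B\<bar> * M + L * \<bar>C\<bar>) * dist x y"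
      by (simp add: dist_real_def algebra_simps)
  qed (simp add: lipschitz_on_nonneg[OF L] lipschitz_on_nonneg[OF M])
  then show ?case
    by blast
qed

text \<open>
  So the squared norm is itself a candidate for the Lyapunov function \<open>u \<bullet> \<phi> x\<close> as soon as \<open>\<phi>\<close> spans
  the quadratic polynomials; this gives a feasible point.
\<close>

lemma polys_norm_affine_squared: "(\<lambda>x. (norm (\<Lambda> *v x + \<mu>))\<^sup>2) \<in> polys 2"
proof -
  have "(\<lambda>x. \<Sum>j\<in>UNIV. \<Lambda> $ i $ j * x $ j) \<in> polys 1" for i
    by (intro polys_sum polys_cmult polys_coord)
  then have affine: "(\<lambda>x. (\<Lambda> *v x) $ i + \<mu> $ i) \<in> polys 1" for i
    unfolding matrix_vector_mult_def by (simp add: polys_add polys_const)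
  have "(\<lambda>x. \<Sum>i\<in>UNIV. ((\<Lambda> *v x) $ i + \<mu> $ i) * ((\<Lambda> *v x) $ i + \<mu> $ i)) \<in> polys 2"
    using polys_mult[OF affine affine] by (intro polys_sum) (simp add: numeral_2_eq_2)
  then show ?thesis
    by (simp add: power2_norm_eq_inner inner_vec_def)
qed

section \<open>Sums of squares\<close>

text \<open>
  The degree bound on the sum is automatic from the degree bound on the squared polynomials.
\<close>

lemma sosI:
  fixes k :: nat
  assumes "\<And>j. j \<in> {1..k} \<Longrightarrow> \<rho> j \<in> polys (d div 2)"
    and "\<And>x. \<sigma> x = (\<Sum>j=1..k. (\<rho> j x)\<^sup>2)"
  shows "\<sigma> \<in> sos d"
proof -
  have \<sigma>: "\<sigma> = (\<lambda>x. \<Sum>j=1..k. (\<rho> j x)\<^sup>2)"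
    using assms(2) by (intro ext)
  have "(\<lambda>x. (\<rho> j x)\<^sup>2) \<in> polys d" if "j \<in> {1..k}" for j
  proof -
    have "d div 2 + d div 2 \<le> d"
      by simp
    then show ?thesis
      using polys_mult[OF assms(1)[OF that] assms(1)[OF that]] polys_mono
      unfolding power2_eq_square by blast
  qed
  then have "\<sigma> \<in> polys d"
    unfolding \<sigma> by (rule polys_sum)
  then show ?thesis
    unfolding sos_def using assms(1) \<sigma> by blast
qed

lemma sosE:
  assumes "\<sigma> \<in> sos d"
  obtains k \<rho> where "\<And>j. j \<in> {1..k} \<Longrightarrow> \<rho> j \<in> polys (d div 2)"
    and "\<And>x. \<sigma> x = (\<Sum>j=1..(k::nat). (\<rho> j x)\<^sup>2)"
proof -
  from assms obtain k \<rho> where "\<forall>j\<in>{1..(k::nat)}. \<rho> j \<in> polys (d div 2)"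
    and "\<sigma> = (\<lambda>x. \<Sum>j=1..k. (\<rho> j x)\<^sup>2)"
    unfolding sos_def by blast
  then show thesis
    by (intro that[of k \<rho>]) auto
qed

lemma sos_nonneg: "\<sigma> \<in> sos d \<Longrightarrow> 0 \<le> \<sigma> x"
  by (erule sosE) (simp add: sum_nonneg)

lemma sos_zero: "(\<lambda>x. 0) \<in> sos d"
  by (rule sosI[of 0]) auto

lemma sos_square:
  assumes "\<rho> \<in> polys (d div 2)"
  shows "(\<lambda>x. (\<rho> x)\<^sup>2) \<in> sos d"
  using assms by (intro sosI[of 1 "\<lambda>_. \<rho>"]) simp_all

lemma sos_add:
  assumes "\<sigma> \<in> sos d" "\<tau> \<in> sos d"
  shows "(\<lambda>x. \<sigma> x + \<tau> x) \<in> sos d"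
proof -
  obtain k \<rho> where \<rho>: "\<And>j. j \<in> {1..k} \<Longrightarrow> \<rho> j \<in> polys (d div 2)"
    and \<sigma>: "\<And>x. \<sigma> x = (\<Sum>j=1..(k::nat). (\<rho> j x)\<^sup>2)"
    using assms(1) by (rule sosE) blast
  obtain l \<theta> where \<theta>: "\<And>j. j \<in> {1..l} \<Longrightarrow> \<theta> j \<in> polys (d div 2)"
    and \<tau>: "\<And>x. \<tau> x = (\<Sum>j=1..(l::nat). (\<theta> j x)\<^sup>2)"
    using assms(2) by (rule sosE) blast
  define \<kappa> where "\<kappa> j = (if j \<le> k then \<rho> j else \<theta> (j - k))" for j
  have \<kappa>: "\<kappa> j \<in> polys (d div 2)" if "j \<in> {1..k + l}" for j
    using that \<rho>[of j] \<theta>[of "j - k"] by (cases "j \<le> k") (auto simp: \<kappa>_def le_diff_conv)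
  have eq: "\<sigma> x + \<tau> x = (\<Sum>j=1..k + l. (\<kappa> j x)\<^sup>2)" for x
  proof -
    have "(\<Sum>j=1..k + l. (\<kappa> j x)\<^sup>2) = (\<Sum>j=1..k. (\<kappa> j x)\<^sup>2) + (\<Sum>j=1+k..l+k. (\<kappa> j x)\<^sup>2)"
      by (subst sum.ub_add_nat) (simp_all add: add.commute)
    also have "(\<Sum>j=1+k..l+k. (\<kappa> j x)\<^sup>2) = (\<Sum>j=1..l. (\<theta> j x)\<^sup>2)"
      by (subst sum.shift_bounds_cl_nat_ivl) (simp add: \<kappa>_def)
    finally show ?thesis
      by (simp add: \<sigma> \<tau> \<kappa>_def)
  qed
  show ?thesis
    by (rule sosI[OF \<kappa> eq])
qed

lemma sos_cmult:
  assumes "\<sigma> \<in> sos d" "0 \<le> c"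
  shows "(\<lambda>x. c * \<sigma> x) \<in> sos d"
  using assms(1)
proof (rule sosE)
  fix k :: nat and \<rho>
  assume \<rho>: "\<And>j. j \<in> {1..k} \<Longrightarrow> \<rho> j \<in> polys (d div 2)"
    and \<sigma>: "\<And>x. \<sigma> x = (\<Sum>j=1..k. (\<rho> j x)\<^sup>2)"
  show ?thesis
    using \<rho> \<sigma> assms(2)
    by (intro sosI[of k "\<lambda>j x. sqrt c * \<rho> j x"])
      (simp_all add: polys_cmult power_mult_distrib sum_distrib_left)
qed

section \<open>Gram matrices and limits of sums of squares\<close>

definition quadratic_form :: "real ^ 'p ^ 'p \<Rightarrow> real ^ 'p \<Rightarrow> real" where
  "quadratic_form Q b = b \<bullet> (Q *v b)"

definition outer :: "real ^ 'p \<Rightarrow> real ^ 'p ^ 'p" where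
  "outer w = (\<chi> i j. w $ i * w $ j)"

text \<open>
  Evaluated at the vector \<open>B x\<close> of basis polynomials, the rank-one matrix of \<open>w\<close> represents the
  square of the polynomial with coefficients \<open>w\<close>.
\<close>

lemma quadratic_form_outer: "quadratic_form (outer w) b = (w \<bullet> b)\<^sup>2"
  unfolding quadratic_form_def outer_def inner_vec_def matrix_vector_mult_def power2_eq_square
  by (simp add: sum_product sum_distrib_left mult_ac)

lemma quadratic_form_add: "quadratic_form (Q + R) b = quadratic_form Q b + quadratic_form R b"
  by (simp add: quadratic_form_def matrix_vector_mult_add_rdistrib inner_add_right)

lemma quadratic_form_scaleR: "quadratic_form (c *\<^sub>R Q) b = c * quadratic_form Q b"
  by (simp add: quadratic_form_def scaleR_matrix_vector_assoc[symmetric])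

lemma continuous_on_quadratic_form: "continuous_on S (\<lambda>Q. quadratic_form Q b)"
  unfolding quadratic_form_def inner_vec_def matrix_vector_mult_def by (simp, intro continuous_intros)

text \<open>
  The number of squares is not bounded in advance, so one cannot simply extract a convergent
  subsequence of each squared polynomial. Gram matrices remove this difficulty: the convex hull of the
  rank-one matrices of unit vectors is compact, and every sum of squares is a nonnegative multiple
  of a quadratic form taken from it. A limit matrix \<open>R\<close> in this hull is positive at some \<open>B x\<^sub>0\<close>, by
  linear independence of the basis; the values at \<open>x\<^sub>0\<close> then determine the limit of the multiples.
  
  The basis may span polynomials of any degree \<open>e\<close> that is large enough for the squared
  polynomials, since those form a subspace of the span.
\<close>

lemma sos_pointwise_closed:
  fixes B :: "real ^ 'n \<Rightarrow> real ^ 'p"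
    and \<sigma> :: "nat \<Rightarrow> real ^ 'n \<Rightarrow> real"
  assumes B: "poly_basis e B" and de: "d div 2 \<le> e"
    and \<sigma>: "\<And>k. \<sigma> k \<in> sos d"
    and lim: "\<And>x. (\<lambda>k. \<sigma> k x) \<longlonglongrightarrow> g x"
  shows "g \<in> sos d"
proof -
  \<comment> \<open>coefficient vectors of the polynomials that are allowed as squared terms\<close>
  define S where "S = {w. (\<lambda>x. w \<bullet> B x) \<in> polys (d div 2)}"
  have indep: "w = 0" if "\<And>x. w \<bullet> B x = 0" for w
    using B that unfolding poly_basis_def by presburger
  have repr: "\<exists>w. w \<in> S \<and> f = (\<lambda>x. w \<bullet> B x)" if f: "f \<in> polys (d div 2)" for f
  proof -
    have "f \<in> range (\<lambda>u x. u \<bullet> B x)"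
      using f polys_mono[OF de] B unfolding poly_basis_def by blast
    then show ?thesis
      using f unfolding S_def by blast
  qed
  have S: "subspace S"
    unfolding subspace_def S_def
    by (auto simp: polys_zero inner_add_left polys_add polys_cmult)
  define H where "H = convex hull (outer ` (sphere 0 1 \<inter> S))"
  have "continuous_on (sphere 0 1 \<inter> S) outer"
    unfolding outer_def by (intro continuous_intros)
  then have "compact H"
    unfolding H_def
    by (intro compact_convex_hull compact_continuous_image compact_Int_closed compact_sphere
        closed_subspace S)
  \<comment> \<open>both properties of \<open>H\<close> hold for the rank-one matrices and define convex sets of matrices\<close>
  have H_sos: "(\<lambda>x. quadratic_form Q (B x)) \<in> sos d" if "Q \<in> H" for Q
  proof -
    have "convex {Q. (\<lambda>x. quadratic_form Q (B x)) \<in> sos d}"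
      unfolding convex_def by (auto simp: quadratic_form_add quadratic_form_scaleR intro!: sos_add sos_cmult)
    moreover have "outer ` (sphere 0 1 \<inter> S) \<subseteq> {Q. (\<lambda>x. quadratic_form Q (B x)) \<in> sos d}"
      by (auto simp: quadratic_form_outer S_def intro: sos_square)
    ultimately show ?thesis
      using that hull_minimal unfolding H_def by blast
  qed
  have H_pos: "\<exists>x. 0 < quadratic_form Q (B x)" if "Q \<in> H" for Q
  proof -
    let ?P = "{Q. (\<forall>x. 0 \<le> quadratic_form Q (B x)) \<and> (\<exists>x. 0 < quadratic_form Q (B x))}"
    have "convex ?P"
      unfolding convex_def
    proof (intro ballI allI impI)
      fix Q R and u v :: real
      assume Q: "Q \<in> ?P" and R: "R \<in> ?P" and u: "0 \<le> u" and v: "0 \<le> v" and uv: "u + v = 1"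
      have "\<exists>x. 0 < u * quadratic_form Q (B x) + v * quadratic_form R (B x)"
      proof (cases "u = 0")
        case True
        then show ?thesis using R uv by auto
      next
        case False
        obtain x where "0 < quadratic_form Q (B x)"
          using Q by blast
        then have "0 < u * quadratic_form Q (B x) + v * quadratic_form R (B x)"
          using False u v R by (intro add_pos_nonneg) auto
        then show ?thesis ..
      qed
      then show "u *\<^sub>R Q + v *\<^sub>R R \<in> ?P"
        using Q R u v by (simp add: quadratic_form_add quadratic_form_scaleR)
    qed
    moreover have "outer w \<in> ?P" if "w \<in> sphere 0 1 \<inter> S" for w
    proof -
      have "w \<noteq> 0"
        using that by auto
      then obtain x where "w \<bullet> B x \<noteq> 0"
        using indep by blast
      then show ?thesis
        by (auto simp: quadratic_form_outer)
    qed
    ultimately have "H \<subseteq> ?P"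
      unfolding H_def by (intro hull_minimal) auto
    then show ?thesis
      using that by blast
  qed
  \<comment> \<open>normalizing the coefficient vectors writes a sum of squares as a multiple of a convex combination\<close>
  have H_cone: "\<exists>t Q. 0 \<le> t \<and> Q \<in> H \<and> (\<forall>x. \<tau> x = t * quadratic_form Q (B x))" if \<tau>_sos: "\<tau> \<in> sos d" for \<tau>
  proof -
    obtain k \<rho> where \<rho>: "\<And>j. j \<in> {1..k} \<Longrightarrow> \<rho> j \<in> polys (d div 2)"
      and \<tau>: "\<And>x. \<tau> x = (\<Sum>j=1..(k::nat). (\<rho> j x)\<^sup>2)"
      using \<tau>_sos by (rule sosE) blast
    have square: "\<exists>t Q. 0 \<le> t \<and> Q \<in> H \<and> (\<forall>x. (f x)\<^sup>2 = t * quadratic_form Q (B x))"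
      if f: "f \<in> polys (d div 2)" "f \<noteq> (\<lambda>x. 0)" for f
    proof -
      obtain w where w: "w \<in> S" "f = (\<lambda>x. w \<bullet> B x)"
        using repr f(1) by blast
      then have "w \<noteq> 0"
        using f(2) by auto
      then have "(w /\<^sub>R norm w) \<in> sphere 0 1 \<inter> S"
        using w(1) S by (auto simp: subspace_scale)
      then have "outer (w /\<^sub>R norm w) \<in> H"
        unfolding H_def by (intro hull_inc imageI)
      moreover have "(f x)\<^sup>2 = (norm w)\<^sup>2 * quadratic_form (outer (w /\<^sub>R norm w)) (B x)" for x
        using \<open>w \<noteq> 0\<close> by (simp add: quadratic_form_outer w(2) power_mult_distrib field_simps)
      ultimately show ?thesis
        by (intro exI[of _ "(norm w)\<^sup>2"] exI[of _ "outer (w /\<^sub>R norm w)"]) simp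
    qed
    \<comment> \<open>\<open>H\<close> is nonempty, so the empty sum is a multiple of one of its points as well\<close>
    obtain Q\<^sub>0 where Q\<^sub>0: "Q\<^sub>0 \<in> H"
      using square[OF polys_const, of 1] by (auto simp: fun_eq_iff)
    have "\<exists>t Q. 0 \<le> t \<and> Q \<in> H \<and> (\<forall>x. (\<Sum>j=1..l. (\<rho> j x)\<^sup>2) = t * quadratic_form Q (B x))" if "l \<le> k" for l
      using that
    proof (induction l)
      case 0
      show ?case
        using Q\<^sub>0 by (intro exI[of _ 0] exI[of _ Q\<^sub>0]) auto
    next
      case (Suc l)
      then obtain t Q where t: "0 \<le> t" and Q: "Q \<in> H"
        and sum: "\<And>x. (\<Sum>j=1..l. (\<rho> j x)\<^sup>2) = t * quadratic_form Q (B x)"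
        by auto
      show ?case
      proof (cases "\<rho> (Suc l) = (\<lambda>x. 0)")
        case True
        then show ?thesis
          using t Q sum by (intro exI[of _ t] exI[of _ Q]) simp
      next
        case False
        then obtain s R where s: "0 \<le> s" and R: "R \<in> H"
          and sq: "\<And>x. (\<rho> (Suc l) x)\<^sup>2 = s * quadratic_form R (B x)"
          using square[OF \<rho>[of "Suc l"]] Suc.prems by auto
        show ?thesis
        proof (cases "t + s = 0")
          case True
          then have "t = 0" "s = 0"
            using s t by auto
          then show ?thesis
            using sum sq Q\<^sub>0 by (intro exI[of _ 0] exI[of _ Q\<^sub>0]) simp
        next
          case False
          have "(t / (t + s)) *\<^sub>R Q + (s / (t + s)) *\<^sub>R R \<in> H"
            using False s t Q R convex_convex_hull[of "outer ` (sphere 0 1 \<inter> S)"]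
            unfolding H_def[symmetric] convex_def
            by (auto simp: add_divide_distrib[symmetric])
          moreover have "(\<Sum>j=1..Suc l. (\<rho> j x)\<^sup>2)
              = (t + s) * quadratic_form ((t / (t + s)) *\<^sub>R Q + (s / (t + s)) *\<^sub>R R) (B x)" for x
            using False sum sq by (simp add: quadratic_form_add quadratic_form_scaleR distrib_left)
          ultimately show ?thesis
            using s t
            by (intro exI[of _ "t + s"] exI[of _ "(t / (t + s)) *\<^sub>R Q + (s / (t + s)) *\<^sub>R R"]) simp
        qed
      qed
    qed
    then show ?thesis
      using \<tau> by simp
  qed
  obtain t Q where t: "\<And>k. 0 \<le> t k" and Q: "\<And>k. Q k \<in> H"
    and tQ: "\<And>k x. \<sigma> k x = t k * quadratic_form (Q k) (B x)"
    using H_cone[OF \<sigma>] by metis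
  obtain R r where R: "R \<in> H" and r: "strict_mono r" and conv: "(Q \<circ> r) \<longlonglongrightarrow> R"
    using \<open>compact H\<close> Q unfolding compact_def by metis
  have quad_lim: "(\<lambda>k. quadratic_form (Q (r k)) b) \<longlonglongrightarrow> quadratic_form R b" for b
    using continuous_on_tendsto_compose[OF continuous_on_quadratic_form[of UNIV] conv] by (simp add: o_def)
  obtain x\<^sub>0 where x\<^sub>0: "0 < quadratic_form R (B x\<^sub>0)"
    using H_pos[OF R] by blast
  define s where "s = g x\<^sub>0 / quadratic_form R (B x\<^sub>0)"
  have sub_lim: "(\<lambda>k. \<sigma> (r k) x) \<longlonglongrightarrow> g x" for x
    using LIMSEQ_subseq_LIMSEQ[OF lim r] by (simp add: o_def)
  have "(\<lambda>k. \<sigma> (r k) x\<^sub>0 / quadratic_form (Q (r k)) (B x\<^sub>0)) \<longlonglongrightarrow> s"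
    unfolding s_def using x\<^sub>0 by (intro tendsto_divide sub_lim quad_lim) simp
  moreover have "\<forall>\<^sub>F k in sequentially. \<sigma> (r k) x\<^sub>0 / quadratic_form (Q (r k)) (B x\<^sub>0) = t (r k)"
    using order_tendstoD(1)[OF quad_lim x\<^sub>0] by eventually_elim (simp add: tQ)
  ultimately have t_lim: "(\<lambda>k. t (r k)) \<longlonglongrightarrow> s"
    by (rule Lim_transform_eventually)
  have "g x = s * quadratic_form R (B x)" for x
  proof (rule LIMSEQ_unique[OF sub_lim])
    show "(\<lambda>k. \<sigma> (r k) x) \<longlonglongrightarrow> s * quadratic_form R (B x)"
      unfolding tQ by (intro tendsto_mult t_lim quad_lim)
  qed
  moreover have "0 \<le> s"
    using t_lim t by (intro LIMSEQ_le_const) auto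
  ultimately show ?thesis
    using sos_cmult[OF H_sos[OF R]] by presburger
qed

section \<open>Ordinary differential equations\<close>

text \<open>
  The function \<open>g t * exp (- k * t)\<close> has nonpositive derivative. The sign of \<open>k\<close> is arbitrary: a
  positive \<open>k\<close> gives uniqueness of solutions, a negative one the decay of a Lyapunov function.
\<close>

lemma linear_differential_inequality:
  fixes g g' :: "real \<Rightarrow> real"
  assumes T: "0 \<le> T"
    and g: "\<And>t. t \<in> {0..T} \<Longrightarrow> (g has_real_derivative g' t) (at t within {0..T})"
    and le: "\<And>t. t \<in> {0..T} \<Longrightarrow> g' t \<le> k * g t"
  shows "g T \<le> g 0 * exp (k * T)"
proof -
  define h where "h t = g t * exp (- (k * t))" for t
  define h' where "h' t = (g' t - k * g t) * exp (- (k * t))" for t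
  have "(h has_derivative (\<lambda>s. h' t * s)) (at t within {0..T})" if "0 \<le> t" "t \<le> T" for t
  proof -
    have "(h has_real_derivative h' t) (at t within {0..T})"
      unfolding h_def h'_def using that
      by (auto intro!: derivative_eq_intros g simp: algebra_simps)
    then show ?thesis
      by (simp add: has_field_derivative_def mult_commute_abs)
  qed
  then obtain t where t: "t \<in> {0..T}" "h T - h 0 = h' t * (T - 0)"
    using mvt_very_simple[OF T, of h "\<lambda>t s. h' t * s"] by auto
  have "h' t \<le> 0"
    unfolding h'_def using le[OF t(1)] by (intro mult_nonpos_nonneg) auto
  then have "h T \<le> h 0"
    using t(2) T mult_nonpos_nonneg[of "h' t" T] by simp
  then have "h T * exp (k * T) \<le> h 0 * exp (k * T)"
    by (intro mult_right_mono) auto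
  then show ?thesis
    by (simp add: h_def mult.assoc exp_add[symmetric])
qed

text \<open>
  The squared distance of two solutions grows at most exponentially with rate \<open>2 * L\<close> and vanishes
  initially.
\<close>

lemma lipschitz_ode_unique:
  fixes f :: "'a::euclidean_space \<Rightarrow> 'a"
  assumes f: "L-lipschitz_on S f" and T: "0 \<le> T"
    and X: "\<And>t. t \<in> {0..T} \<Longrightarrow> (X has_vector_derivative f (X t)) (at t within {0..T})"
    and Y: "\<And>t. t \<in> {0..T} \<Longrightarrow> (Y has_vector_derivative f (Y t)) (at t within {0..T})"
    and XS: "\<And>t. t \<in> {0..T} \<Longrightarrow> X t \<in> S" and YS: "\<And>t. t \<in> {0..T} \<Longrightarrow> Y t \<in> S"
    and init: "X 0 = Y 0"
  shows "X T = Y T"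
proof -
  define g where "g t = (X t - Y t) \<bullet> (X t - Y t)" for t
  define g' where "g' t = 2 * ((X t - Y t) \<bullet> (f (X t) - f (Y t)))" for t
  have g: "(g has_real_derivative g' t) (at t within {0..T})" if t: "t \<in> {0..T}" for t
  proof -
    have "((\<lambda>s. X s - Y s) has_derivative (\<lambda>h. h *\<^sub>R (f (X t) - f (Y t)))) (at t within {0..T})"
      using has_vector_derivative_diff[OF X[OF t] Y[OF t]] by (simp add: has_vector_derivative_def)
    from has_derivative_inner[OF this this]
    have "(g has_derivative (\<lambda>h. g' t * h)) (at t within {0..T})"
      unfolding g_def[abs_def] g'_def by (simp add: inner_commute algebra_simps)
    then show ?thesis
      by (simp add: has_field_derivative_def)
  qed
  have le: "g' t \<le> (2 * L) * g t" if t: "t \<in> {0..T}" for t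
  proof -
    have "(X t - Y t) \<bullet> (f (X t) - f (Y t)) \<le> norm (X t - Y t) * norm (f (X t) - f (Y t))"
      by (rule norm_cauchy_schwarz)
    also have "\<dots> \<le> norm (X t - Y t) * (L * norm (X t - Y t))"
      by (intro mult_left_mono lipschitz_on_normD[OF f XS[OF t] YS[OF t]]) simp
    finally show ?thesis
      by (simp add: g_def g'_def power2_norm_eq_inner[symmetric] power2_eq_square mult.left_commute)
  qed
  have "g T \<le> g 0 * exp (2 * L * T)"
    by (rule linear_differential_inequality[OF T g le])
  then have "(norm (X T - Y T))\<^sup>2 \<le> 0"
    by (simp add: g_def init power2_norm_eq_inner)
  then show ?thesis
    by simp
qed

lemma indefinite_integral_has_vector_derivative:
  fixes g :: "real \<Rightarrow> 'a::banach"
  assumes "continuous_on UNIV g" and t: "t \<in> {0..}"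
  shows "((\<lambda>s. integral {0..s} g) has_vector_derivative g t) (at t within {0..})"
proof -
  have "((\<lambda>s. integral {0..s} g) has_vector_derivative g t) (at t within {0..t + 1})"
    using t by (intro integral_has_vector_derivative continuous_on_subset[OF assms(1)]) auto
  moreover have "at t within {0..t + 1} = at t within {0..}"
    by (rule at_within_nhd[where S = "{..<t + 1}"]) auto
  ultimately show ?thesis
    by simp
qed

text \<open>
  The integral equation for \<open>X\<close> is solved on the whole half-line at once by rescaling: for
  \<open>y t = exp (- \<kappa> * t) *\<^sub>R X t\<close> it becomes a fixed point equation in the complete space of bounded
  continuous functions, and the right-hand side is a contraction with factor \<open>L / \<kappa>\<close>. The bound on
  \<open>f\<close> keeps the right-hand side in that space.
\<close>

lemma lipschitz_bounded_ode_exists: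
  fixes f :: "real ^ 'n \<Rightarrow> real ^ 'n"
  assumes f: "L-lipschitz_on UNIV f" and M: "\<And>x. norm (f x) \<le> M"
  shows "\<exists>X. solves_ivp f x0 {0..} X"
proof -
  define \<kappa> where "\<kappa> = L + 1"
  have L: "0 \<le> L"
    using f by (rule lipschitz_on_nonneg)
  have \<kappa>: "1 \<le> \<kappa>" "L < \<kappa>"
    using L by (auto simp: \<kappa>_def)
  have M0: "0 \<le> M"
    using M[of 0] norm_ge_zero order_trans by blast
  define G where "G y r = f (exp (\<kappa> * r) *\<^sub>R apply_bcontfun y r)"
    for y :: "real \<Rightarrow>\<^sub>C (real ^ 'n)" and r
  have contG: "continuous_on S (G y)" for S y
  proof -
    have "continuous_on UNIV f"
      using f by (rule lipschitz_on_continuous_on)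
    then show ?thesis
      unfolding G_def by (rule continuous_on_compose2) (auto intro!: continuous_intros)
  qed
  define P where "P y t = exp (- (\<kappa> * t)) *\<^sub>R (x0 + integral {0..t} (G y))" for y t
  have deriv: "((\<lambda>s. integral {0..s} (G y)) has_vector_derivative G y t) (at t within {0..})"
    if "t \<in> {0..}" for y t
    using contG that by (rule indefinite_integral_has_vector_derivative)
  have contP: "continuous_on {0..} (P y)" for y
    unfolding P_def
    by (intro continuous_intros continuous_on_vector_derivative[OF deriv])
  have boundP: "norm (P y t) \<le> norm x0 + M" if t: "0 \<le> t" for y t
  proof -
    have "norm (integral {0..t} (G y)) \<le> M * (t - 0)"
      using t by (intro integral_bound contG) (auto simp: G_def M)
    then have "norm (x0 + integral {0..t} (G y)) \<le> norm x0 + M * t"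
      using norm_triangle_ineq[of x0 "integral {0..t} (G y)"] by simp
    also have "\<dots> \<le> norm x0 * exp (\<kappa> * t) + M * exp (\<kappa> * t)"
    proof (rule add_mono)
      have "t \<le> \<kappa> * t"
        using \<kappa> t by (simp add: mult_le_cancel_right1)
      then have "t \<le> exp (\<kappa> * t)"
        using exp_ge_add_one_self[of "\<kappa> * t"] by linarith
      then show "M * t \<le> M * exp (\<kappa> * t)"
        using M0 by (rule mult_left_mono)
      show "norm x0 \<le> norm x0 * exp (\<kappa> * t)"
        using \<kappa> t by (simp add: mult_le_cancel_left1)
    qed
    finally have "norm (x0 + integral {0..t} (G y)) / exp (\<kappa> * t) \<le> norm x0 + M"
      by (simp add: pos_divide_le_eq distrib_right)
    moreover have "norm (P y t) = norm (x0 + integral {0..t} (G y)) / exp (\<kappa> * t)"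
      by (simp add: P_def exp_minus divide_inverse mult.commute)
    ultimately show ?thesis
      by simp
  qed
  \<comment> \<open>bounded continuous functions live on the whole line, so \<open>P y\<close> is extended by a constant\<close>
  define Q where "Q y = Bcontfun (\<lambda>t. P y (max 0 t))" for y
  have Q: "apply_bcontfun (Q y) t = P y (max 0 t)" for y t
  proof -
    have "(\<lambda>t. P y (max 0 t)) \<in> bcontfun"
    proof (rule bcontfun_normI)
      show "continuous_on UNIV (\<lambda>t. P y (max 0 t))"
        by (rule continuous_on_compose2[OF contP]) (auto intro!: continuous_intros)
      show "norm (P y (max 0 t)) \<le> norm x0 + M" for t
        by (simp add: boundP)
    qed
    then show ?thesis
      by (simp add: Q_def Bcontfun_inverse)
  qed
  have contraction: "dist (Q y) (Q z) \<le> (L / \<kappa>) * dist y z" for y z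
  proof (rule dist_bound)
    fix t :: real
    define s where "s = max 0 t"
    have s: "0 \<le> s"
      by (simp add: s_def)
    have int: "((\<lambda>r. L * dist y z * exp (\<kappa> * r)) has_integral
        L * dist y z * exp (\<kappa> * s) / \<kappa> - L * dist y z * exp (\<kappa> * 0) / \<kappa>) {0..s}"
      using \<kappa> s
      by (intro fundamental_theorem_of_calculus)
        (auto intro!: derivative_eq_intros simp flip: has_real_derivative_iff_has_vector_derivative)
    have "norm (integral {0..s} (G y) - integral {0..s} (G z))
        = norm (integral {0..s} (\<lambda>r. G y r - G z r))"
      by (subst integral_diff) (auto intro!: integrable_continuous_interval contG)
    also have "\<dots> \<le> integral {0..s} (\<lambda>r. L * dist y z * exp (\<kappa> * r))"
    proof (rule integral_norm_bound_integral)
      show "(\<lambda>r. G y r - G z r) integrable_on {0..s}"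
        by (intro integrable_continuous_interval continuous_intros contG)
      show "(\<lambda>r. L * dist y z * exp (\<kappa> * r)) integrable_on {0..s}"
        using int by blast
      fix r
      have "norm (G y r - G z r) \<le> L * dist (exp (\<kappa> * r) *\<^sub>R apply_bcontfun y r) (exp (\<kappa> * r) *\<^sub>R apply_bcontfun z r)"
        unfolding G_def using lipschitz_onD[OF f] by (simp add: dist_norm)
      also have "\<dots> = L * (exp (\<kappa> * r) * dist (apply_bcontfun y r) (apply_bcontfun z r))"
        by (simp add: dist_norm scaleR_diff_right[symmetric])
      also have "\<dots> \<le> L * (exp (\<kappa> * r) * dist y z)"
        using L by (intro mult_left_mono dist_bounded) auto
      finally show "norm (G y r - G z r) \<le> L * dist y z * exp (\<kappa> * r)"
        by (simp add: mult_ac)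
    qed
    also have "\<dots> = L * dist y z * exp (\<kappa> * s) / \<kappa> - L * dist y z / \<kappa>"
      using integral_unique[OF int] by simp
    also have "\<dots> \<le> L * dist y z * exp (\<kappa> * s) / \<kappa>"
      using L \<kappa> by simp
    finally have "exp (- (\<kappa> * s)) * norm (integral {0..s} (G y) - integral {0..s} (G z))
        \<le> exp (- (\<kappa> * s)) * (L * dist y z * exp (\<kappa> * s) / \<kappa>)"
      by (rule mult_left_mono) simp
    also have "\<dots> = (L / \<kappa>) * dist y z"
      by (simp add: exp_minus field_simps)
    finally show "dist (apply_bcontfun (Q y) t) (apply_bcontfun (Q z) t) \<le> (L / \<kappa>) * dist y z"
      by (simp add: Q P_def dist_norm s_def[symmetric] scaleR_diff_right[symmetric])
  qed
  obtain y where y: "Q y = y"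
    using banach_fix_type[of "L / \<kappa>" Q] contraction L \<kappa> by auto
  define X where "X t = exp (\<kappa> * t) *\<^sub>R apply_bcontfun y t" for t
  have X: "X t = x0 + integral {0..t} (G y)" if "t \<in> {0..}" for t
    using that Q[of y t] unfolding X_def y P_def by (simp add: exp_minus)
  have "(X has_vector_derivative f (X t)) (at t within {0..})" if t: "t \<in> {0..}" for t
  proof (rule has_vector_derivative_transform[OF t X])
    show "((\<lambda>s. x0 + integral {0..s} (G y)) has_vector_derivative f (X t)) (at t within {0..})"
      using has_vector_derivative_add[OF has_vector_derivative_const deriv[OF t]]
      by (simp add: G_def X_def)
  qed
  moreover have "X 0 = x0"
    using X[of 0] by simp
  ultimately show ?thesis
    unfolding solves_ivp_def by blast
qed

text \<open>
  The excess \<open>V - \<beta>\<close> along a solution is at most its initial value times a factor in \<open>(0, 1]\<close>: if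
  it starts positive it does not grow, and if it starts nonpositive it stays nonpositive.
\<close>

lemma lyapunov_bound:
  fixes f :: "'a::euclidean_space \<Rightarrow> 'a" and V :: "'a \<Rightarrow> real"
  assumes V: "\<And>x. (V has_derivative DV x) (at x)"
    and decay: "\<And>x. DV x (f x) \<le> k * (\<beta> - V x)" and k: "0 \<le> k"
    and T: "0 \<le> T"
    and X: "\<And>t. t \<in> {0..T} \<Longrightarrow> (X has_vector_derivative f (X t)) (at t within {0..T})"
  shows "V (X T) \<le> max (V (X 0)) \<beta>"
proof -
  have "((\<lambda>t. V (X t) - \<beta>) has_real_derivative DV (X t) (f (X t))) (at t within {0..T})"
    if "t \<in> {0..T}" for t
  proof -
    have "((\<lambda>t. V (X t)) has_derivative (\<lambda>h. DV (X t) (h *\<^sub>R f (X t)))) (at t within {0..T})"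
      using X[OF that] V unfolding has_vector_derivative_def
      by (rule has_derivative_compose)
    then have "((\<lambda>t. V (X t)) has_derivative (\<lambda>h. DV (X t) (f (X t)) * h)) (at t within {0..T})"
      using linear_scale[OF has_derivative_linear[OF V]] by (simp add: mult.commute)
    then have "((\<lambda>t. V (X t)) has_real_derivative DV (X t) (f (X t))) (at t within {0..T})"
      by (simp add: has_field_derivative_def)
    then show ?thesis
      by (auto intro!: derivative_eq_intros)
  qed
  moreover have "DV (X t) (f (X t)) \<le> (- k) * (V (X t) - \<beta>)" for t
    using decay[of "X t"] by (simp add: algebra_simps)
  ultimately have "V (X T) - \<beta> \<le> (V (X 0) - \<beta>) * exp (- k * T)"
    by (intro linear_differential_inequality[OF T])
  also have "\<dots> \<le> max (V (X 0) - \<beta>) 0"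
  proof (cases "V (X 0) \<le> \<beta>")
    case True
    then show ?thesis
      by (simp add: mult_nonpos_nonneg)
  next
    case False
    moreover have "exp (- k * T) \<le> 1"
      using k T by simp
    ultimately show ?thesis
      by (simp add: mult_left_le)
  qed
  finally show ?thesis
    by (simp add: max_def split: if_splits)
qed

text \<open>
  A solution is first constructed for the field composed with the projection \<open>\<pi>\<close> onto a ball. The
  radius \<open>R\<close> is chosen such that the Lyapunov bound confines solutions of the original field to the
  open ball. Up to the first time the constructed solution reaches the sphere of radius \<open>R\<close> it solves
  the original equation, so by the Lyapunov bound it cannot be on the sphere at that time.
\<close>

theorem lyapunov_bounded_solutions:
  fixes f :: "real ^ 'n \<Rightarrow> real ^ 'n" and V :: "real ^ 'n \<Rightarrow> real"
  assumes f: "\<And>R. \<exists>L. L-lipschitz_on (cball 0 R) f"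
    and V: "\<And>x. (V has_derivative DV x) (at x)"
    and decay: "\<And>x. DV x (f x) \<le> k * (\<beta> - V x)" and k: "0 \<le> k"
    and coercive: "\<And>M. bounded {x. V x \<le> M}"
  shows "has_bounded_solutions f"
  unfolding has_bounded_solutions_def
proof
  fix x0 :: "real ^ 'n"
  define M where "M = max (V x0) \<beta>"
  obtain R where R: "0 < R" and sub: "\<And>x. V x \<le> M \<Longrightarrow> norm x < R"
    using coercive[of M] unfolding bounded_pos_less by blast
  note bound = lyapunov_bound[OF V decay k]
  obtain L where L: "L-lipschitz_on (cball 0 R) f"
    using f by blast
  define \<pi> where "\<pi> = closest_point (cball (0 :: real ^ 'n) R)"
  have \<pi>_in: "\<pi> x \<in> cball 0 R" for x
    unfolding \<pi>_def using R by (intro closest_point_in_set) auto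
  have \<pi>_self: "\<pi> x = x" if "norm x \<le> R" for x
    unfolding \<pi>_def using that by (intro closest_point_self) simp
  have "L-lipschitz_on UNIV (\<lambda>x. f (\<pi> x))"
  proof (rule lipschitz_onI)
    fix x y :: "real ^ 'n"
    have "dist (f (\<pi> x)) (f (\<pi> y)) \<le> L * dist (\<pi> x) (\<pi> y)"
      by (rule lipschitz_onD[OF L \<pi>_in \<pi>_in])
    also have "\<dots> \<le> L * dist x y"
      unfolding \<pi>_def using R lipschitz_on_nonneg[OF L]
      by (intro mult_left_mono closest_point_lipschitz) auto
    finally show "dist (f (\<pi> x)) (f (\<pi> y)) \<le> L * dist x y" .
  qed (rule lipschitz_on_nonneg[OF L])
  moreover obtain C where C: "\<And>x. norm (f (\<pi> x)) \<le> C"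
  proof -
    have "compact (f ` cball 0 R)"
      by (intro compact_continuous_image lipschitz_on_continuous_on[OF L] compact_cball)
    then obtain C where "\<forall>y\<in>f ` cball 0 R. norm y \<le> C"
      using compact_imp_bounded bounded_iff[of "f ` cball 0 R"] by blast
    then show ?thesis
      using \<pi>_in that by blast
  qed
  ultimately obtain X where "solves_ivp (\<lambda>x. f (\<pi> x)) x0 {0..} X"
    using lipschitz_bounded_ode_exists by blast
  then have X0: "X 0 = x0"
    and X: "\<And>t. 0 \<le> t \<Longrightarrow> (X has_vector_derivative f (\<pi> (X t))) (at t within {0..})"
    unfolding solves_ivp_def by auto
  have contX: "continuous_on {0..} X"
    using X by (intro continuous_on_vector_derivative) auto
  have cont_norm: "continuous_on {0..t} (\<lambda>s. norm (X s))" for t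
    by (intro continuous_intros continuous_on_subset[OF contX]) auto
  have X0_lt: "norm (X 0) < R"
    using sub[of x0] by (simp add: X0 M_def)
  have X_lt: "norm (X t) < R" if t: "0 \<le> t" for t
  proof (rule ccontr)
    assume nt: "\<not> norm (X t) < R"
    have crossing: "\<exists>s\<in>{0..r}. norm (X s) = R" if "0 \<le> r" "R \<le> norm (X r)" for r
      using IVT'[of "\<lambda>s. norm (X s)" 0 R r] that X0_lt cont_norm by auto
    \<comment> \<open>by continuity the sphere is reached before the ball is left, so there is a first such time\<close>
    define S where "S = {s \<in> {0..t}. norm (X s) = R}"
    have "closed S"
      unfolding S_def by (intro continuous_closed_preimage_constant cont_norm) auto
    then have "compact S"
      by (auto simp: compact_eq_bounded_closed S_def intro: bounded_subset[of "{0..t}"])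
    moreover have "S \<noteq> {}"
      using crossing[of t] t nt by (auto simp: S_def)
    ultimately obtain s where s: "s \<in> S" and min: "\<And>r. r \<in> S \<Longrightarrow> s \<le> r"
      using compact_attains_inf by metis
    have inside: "norm (X r) \<le> R" if r: "r \<in> {0..s}" for r
    proof (rule ccontr)
      assume "\<not> norm (X r) \<le> R"
      then obtain q where q: "q \<in> {0..r}" "norm (X q) = R"
        using crossing[of r] r by auto
      then have "q \<in> S"
        using r s by (auto simp: S_def)
      then have "q = r"
        using min[of q] q(1) r by auto
      then show False
        using q(2) \<open>\<not> norm (X r) \<le> R\<close> by simp
    qed
    have "V (X s) \<le> max (V (X 0)) \<beta>"
    proof (rule bound)
      show "0 \<le> s"
        using s by (simp add: S_def)
      show "(X has_vector_derivative f (X r)) (at r within {0..s})" if "r \<in> {0..s}" for r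
        using X[of r] that \<pi>_self[OF inside[OF that]]
        by (auto intro: has_vector_derivative_within_subset)
    qed
    then have "norm (X s) < R"
      by (intro sub) (simp add: X0 M_def)
    then show False
      using s by (simp add: S_def)
  qed
  have X_sol: "(X has_vector_derivative f (X t)) (at t within {0..})" if "0 \<le> t" for t
    using X[OF that] \<pi>_self[of "X t"] X_lt[OF that] by simp
  show "\<exists>X. solves_ivp f x0 {0..} X \<and> bounded (X ` {0..}) \<and>
      (\<forall>\<tau> Y. \<tau> > 0 \<longrightarrow> solves_ivp f x0 {0..<\<tau>} Y \<longrightarrow> (\<forall>t\<in>{0..<\<tau>}. Y t = X t))"
  proof (intro exI conjI allI impI ballI)
    show "solves_ivp f x0 {0..} X"
      using X_sol X0 by (simp add: solves_ivp_def)
    show "bounded (X ` {0..})"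
      unfolding bounded_iff using X_lt by (intro exI[of _ R]) (auto intro: less_imp_le)
    fix \<tau> Y t
    assume Y: "solves_ivp f x0 {0..<\<tau>} Y" and t: "t \<in> {0..<\<tau>}"
    have Y0: "Y 0 = x0"
      using Y by (simp add: solves_ivp_def)
    have Y_sol: "(Y has_vector_derivative f (Y s)) (at s within {0..r})"
      if "s \<in> {0..r}" "r \<le> t" for s r
    proof (rule has_vector_derivative_within_subset)
      show "(Y has_vector_derivative f (Y s)) (at s within {0..<\<tau>})"
        using Y t that by (simp add: solves_ivp_def)
    qed (use t that in auto)
    \<comment> \<open>the Lyapunov bound applies to any other solution too and confines it to the same ball\<close>
    have Y_lt: "norm (Y s) < R" if s: "s \<in> {0..t}" for s
    proof (rule sub)
      have "V (Y s) \<le> max (V (Y 0)) \<beta>"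
        using s by (intro bound Y_sol) auto
      then show "V (Y s) \<le> M"
        by (simp add: M_def Y0)
    qed
    show "Y t = X t"
    proof (rule lipschitz_ode_unique[OF L])
      show "(X has_vector_derivative f (X s)) (at s within {0..t})" if "s \<in> {0..t}" for s
        using that by (intro has_vector_derivative_within_subset[OF X_sol]) auto
      show "X s \<in> cball 0 R" "Y s \<in> cball 0 R" if "s \<in> {0..t}" for s
        using X_lt[of s] Y_lt[OF that] that by auto
    qed (use t Y_sol X0 Y0 in auto)
  qed
qed

section \<open>Attainment of the minimum\<close>

lemma norm_le_l1_mat: "norm F \<le> l1_mat F"
proof -
  have "norm F \<le> (\<Sum>i\<in>UNIV. norm (F $ i))"
    unfolding norm_vec_def[of F] by (rule L2_set_le_sum) simp
  also have "\<dots> \<le> l1_mat F"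
    unfolding l1_mat_def by (intro sum_mono norm_le_l1_cart)
  finally show ?thesis .
qed

lemma norm_le_l1_vec: "norm u \<le> l1_vec u"
  unfolding l1_vec_def by (rule norm_le_l1_cart)

lemma continuous_on_objective:
  "continuous_on S (objective m xs ys \<zeta> \<epsilon>\<^sub>1 \<epsilon>\<^sub>2 \<epsilon>\<^sub>3 \<epsilon>\<^sub>4)"
  unfolding objective_def l1_mat_def l1_vec_def matrix_vector_mult_def split_beta'
  by (intro continuous_intros)

text \<open>
  For fixed \<open>x\<close> the constraint polynomials depend continuously on the decision variables, so limits
  of feasible points give pointwise limits of sums of squares.
\<close>

lemma closed_feasible:
  fixes \<phi> :: "real ^ 'n \<Rightarrow> real ^ 'p" and \<zeta> :: "real ^ 'n \<Rightarrow> real ^ 'r"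
  assumes \<phi>: "poly_basis d\<^sub>v \<phi>" and \<zeta>: "poly_basis d\<^sub>f \<zeta>"
  shows "closed {z. feasible d\<^sub>v d\<^sub>f \<phi> \<zeta> \<Lambda> \<mu> \<alpha> \<beta> z}"
  unfolding closed_sequential_limits
proof (intro allI impI, elim conjE)
  fix z :: "nat \<Rightarrow> (real ^ 'r ^ 'n) \<times> (real ^ 'p) \<times> real \<times> real" and w
  assume feas: "\<forall>k. z k \<in> {z. feasible d\<^sub>v d\<^sub>f \<phi> \<zeta> \<Lambda> \<mu> \<alpha> \<beta> z}" and lim: "z \<longlonglongrightarrow> w"
  define F u b c where "F k = fst (z k)" and "u k = fst (snd (z k))"
    and "b k = fst (snd (snd (z k)))" and "c k = snd (snd (snd (z k)))" for k
  obtain F' u' b' c' where w: "w = (F', u', b', c')"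
    by (rule prod_cases4)
  have z: "z k = (F k, u k, b k, c k)" for k
    by (simp add: F_def u_def b_def c_def)
  have F: "F \<longlonglongrightarrow> F'" and u: "u \<longlonglongrightarrow> u'" and b: "b \<longlonglongrightarrow> b'" and c: "c \<longlonglongrightarrow> c'"
    unfolding F_def u_def b_def c_def
    using tendsto_fst[OF lim] tendsto_fst[OF tendsto_snd[OF lim]]
      tendsto_fst[OF tendsto_snd[OF tendsto_snd[OF lim]]]
      tendsto_snd[OF tendsto_snd[OF tendsto_snd[OF lim]]]
    by (simp_all add: w)
  have mult_lim: "(\<lambda>k. A k *v v) \<longlonglongrightarrow> A' *v v" if "A \<longlonglongrightarrow> A'"
    for A :: "nat \<Rightarrow> real ^ 'r ^ 'n" and A' v
    unfolding matrix_vector_mult_def by (intro tendsto_intros that)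
  have mult_lim': "(\<lambda>k. A *v v k) \<longlonglongrightarrow> A *v v'" if "v \<longlonglongrightarrow> v'"
    for A :: "real ^ 'p ^ 'n" and v v'
    unfolding matrix_vector_mult_def by (intro tendsto_intros that)
  have feas_z: "feasible d\<^sub>v d\<^sub>f \<phi> \<zeta> \<Lambda> \<mu> \<alpha> \<beta> (F k, u k, b k, c k)" for k
    using feas by (simp add: z[symmetric])
  have feas': "(\<lambda>x. b k - c k * (u k \<bullet> \<phi> x)
        - \<alpha> * ((F k *v \<zeta> x) \<bullet> (transpose (jacobian \<phi> x) *v u k))) \<in> sos (d\<^sub>v + d\<^sub>f - 1)"
      "(\<lambda>x. u k \<bullet> \<phi> x - (norm (\<Lambda> *v x + \<mu>))\<^sup>2) \<in> sos d\<^sub>v"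
      "0 \<le> c k" "c k \<le> 1" "\<bar>b k\<bar> \<le> \<beta> * c k" for k
    using feas_z[of k] unfolding feasible_def by simp_all
  have lim1: "(\<lambda>k. b k - c k * (u k \<bullet> \<phi> x)
        - \<alpha> * ((F k *v \<zeta> x) \<bullet> (transpose (jacobian \<phi> x) *v u k)))
      \<longlonglongrightarrow> b' - c' * (u' \<bullet> \<phi> x) - \<alpha> * ((F' *v \<zeta> x) \<bullet> (transpose (jacobian \<phi> x) *v u'))" for x
    by (intro tendsto_intros F u b c mult_lim mult_lim')
  have lim2: "(\<lambda>k. u k \<bullet> \<phi> x - (norm (\<Lambda> *v x + \<mu>))\<^sup>2)
      \<longlonglongrightarrow> u' \<bullet> \<phi> x - (norm (\<Lambda> *v x + \<mu>))\<^sup>2" for x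
    by (intro tendsto_intros u)
  have "(\<lambda>x. b' - c' * (u' \<bullet> \<phi> x) - \<alpha> * ((F' *v \<zeta> x) \<bullet> (transpose (jacobian \<phi> x) *v u')))
      \<in> sos (d\<^sub>v + d\<^sub>f - 1)"
  \<comment> \<open>the squared polynomials have degree below \<open>max d\<^sub>v d\<^sub>f\<close>: one of the two given bases spans them\<close>
  proof (cases "d\<^sub>f \<le> d\<^sub>v")
    case True
    then have "(d\<^sub>v + d\<^sub>f - 1) div 2 \<le> d\<^sub>v"
      by simp
    then show ?thesis
      by (rule sos_pointwise_closed[OF \<phi> _ feas'(1) lim1])
  next
    case False
    then have "(d\<^sub>v + d\<^sub>f - 1) div 2 \<le> d\<^sub>f"
      by simp
    then show ?thesis
      by (rule sos_pointwise_closed[OF \<zeta> _ feas'(1) lim1])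
  qed
  moreover have "(\<lambda>x. u' \<bullet> \<phi> x - (norm (\<Lambda> *v x + \<mu>))\<^sup>2) \<in> sos d\<^sub>v"
    by (rule sos_pointwise_closed[OF \<phi> _ feas'(2) lim2]) simp
  moreover have "0 \<le> c'" "c' \<le> 1"
    using LIMSEQ_le_const[OF c] LIMSEQ_le_const2[OF c] feas'(3,4) by blast+
  moreover have "\<bar>b'\<bar> \<le> \<beta> * c'"
    using feas'(5) by (intro LIMSEQ_le[OF tendsto_rabs[OF b] tendsto_mult_left[OF c]]) auto
  ultimately show "w \<in> {z. feasible d\<^sub>v d\<^sub>f \<phi> \<zeta> \<Lambda> \<mu> \<alpha> \<beta> z}"
    by (simp add: w feasible_def)
qed

text \<open>
  The penalties bound \<open>F\<close> and \<open>u\<close>; the constraints bound \<open>b\<close> and \<open>c\<close>.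
\<close>

lemma bounded_feasible_sublevel:
  assumes "\<epsilon>\<^sub>1 > 0" "\<epsilon>\<^sub>2 > 0" "\<epsilon>\<^sub>3 > 0" "\<epsilon>\<^sub>4 > 0" and \<beta>: "\<beta> > 0"
  shows "bounded {z. feasible d\<^sub>v d\<^sub>f \<phi> \<zeta> \<Lambda> \<mu> \<alpha> \<beta> z \<and> objective m xs ys \<zeta> \<epsilon>\<^sub>1 \<epsilon>\<^sub>2 \<epsilon>\<^sub>3 \<epsilon>\<^sub>4 z \<le> K}"
proof -
  have "norm z \<le> K / \<epsilon>\<^sub>2 + (K / \<epsilon>\<^sub>4 + (\<beta> + 1))"
    if feas: "feasible d\<^sub>v d\<^sub>f \<phi> \<zeta> \<Lambda> \<mu> \<alpha> \<beta> z" and obj: "objective m xs ys \<zeta> \<epsilon>\<^sub>1 \<epsilon>\<^sub>2 \<epsilon>\<^sub>3 \<epsilon>\<^sub>4 z \<le> K" for z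
  proof -
    obtain F u b c where z: "z = (F, u, b, c)"
      by (rule prod_cases4)
    have nonneg: "0 \<le> sqrt (\<Sum>i=1..m. (norm (F *v \<zeta> (xs i) - ys i))\<^sup>2)"
      "0 \<le> \<epsilon>\<^sub>1 * \<bar>c - 1\<bar>" "0 \<le> \<epsilon>\<^sub>3 * \<bar>b\<bar>" "0 \<le> \<epsilon>\<^sub>2 * l1_mat F" "0 \<le> \<epsilon>\<^sub>4 * l1_vec u"
      using assms by (simp_all add: sum_nonneg l1_mat_def l1_vec_def)
    have "\<epsilon>\<^sub>2 * l1_mat F \<le> K" "\<epsilon>\<^sub>4 * l1_vec u \<le> K"
      using obj nonneg unfolding z objective_def prod.case by linarith+
    then have "l1_mat F \<le> K / \<epsilon>\<^sub>2" "l1_vec u \<le> K / \<epsilon>\<^sub>4"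
      using assms by (simp_all add: pos_le_divide_eq mult.commute)
    then have "norm F \<le> K / \<epsilon>\<^sub>2" "norm u \<le> K / \<epsilon>\<^sub>4"
      using norm_le_l1_mat[of F] norm_le_l1_vec[of u] by linarith+
    moreover have c: "0 \<le> c" "c \<le> 1" and b: "\<bar>b\<bar> \<le> \<beta> * c"
      using feas by (auto simp: z feasible_def)
    have "\<beta> * c \<le> \<beta>"
      using \<beta> c by simp
    then have "norm b \<le> \<beta>" "norm c \<le> 1"
      using b c by auto
    ultimately show ?thesis
      unfolding z
      by (intro order_trans[OF norm_Pair_le] add_mono)
  qed
  then show ?thesis
    unfolding bounded_iff by blast
qed

text \<open>
  For \<open>F = 0\<close> and \<open>b = c = 0\<close> the first polynomial is zero, and so is the second one for the \<open>u\<close>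
  that represents \<open>\<parallel>\<Lambda> x + \<mu>\<parallel>\<^sup>2\<close>.
\<close>

lemma feasible_exists:
  assumes \<phi>: "poly_basis d\<^sub>v \<phi>" and d\<^sub>v: "2 \<le> d\<^sub>v"
  shows "\<exists>z. feasible d\<^sub>v d\<^sub>f \<phi> \<zeta> \<Lambda> \<mu> \<alpha> \<beta> z"
proof -
  have "(\<lambda>x. (norm (\<Lambda> *v x + \<mu>))\<^sup>2) \<in> range (\<lambda>u x. u \<bullet> \<phi> x)"
    using polys_norm_affine_squared[of \<Lambda> \<mu>] polys_mono[OF d\<^sub>v] \<phi> unfolding poly_basis_def by blast
  then obtain u where "(\<lambda>x. (norm (\<Lambda> *v x + \<mu>))\<^sup>2) = (\<lambda>x. u \<bullet> \<phi> x)"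
    by blast
  then have "u \<bullet> \<phi> x = (norm (\<Lambda> *v x + \<mu>))\<^sup>2" for x
    by (metis)
  then have "feasible d\<^sub>v d\<^sub>f \<phi> \<zeta> \<Lambda> \<mu> \<alpha> \<beta> (0, u, 0, 0)"
    by (simp add: feasible_def sos_zero)
  then show ?thesis ..
qed

lemma minimum_attained:
  assumes \<phi>: "poly_basis d\<^sub>v \<phi>" and \<zeta>: "poly_basis d\<^sub>f \<zeta>" and d\<^sub>v: "2 \<le> d\<^sub>v"
    and pos: "\<beta> > 0" "\<epsilon>\<^sub>1 > 0" "\<epsilon>\<^sub>2 > 0" "\<epsilon>\<^sub>3 > 0" "\<epsilon>\<^sub>4 > 0"
  shows "\<exists>z. is_arg_min (objective m xs ys \<zeta> \<epsilon>\<^sub>1 \<epsilon>\<^sub>2 \<epsilon>\<^sub>3 \<epsilon>\<^sub>4) (feasible d\<^sub>v d\<^sub>f \<phi> \<zeta> \<Lambda> \<mu> \<alpha> \<beta>) z"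
proof -
  let ?obj = "objective m xs ys \<zeta> \<epsilon>\<^sub>1 \<epsilon>\<^sub>2 \<epsilon>\<^sub>3 \<epsilon>\<^sub>4"
  let ?feas = "feasible d\<^sub>v d\<^sub>f \<phi> \<zeta> \<Lambda> \<mu> \<alpha> \<beta>"
  obtain z\<^sub>0 where z\<^sub>0: "?feas z\<^sub>0"
    using feasible_exists[OF \<phi> d\<^sub>v] by blast
  define S where "S = {z. ?feas z \<and> ?obj z \<le> ?obj z\<^sub>0}"
  have "closed S"
    unfolding S_def
    by (intro closed_Collect_conj closed_feasible \<phi> \<zeta> closed_Collect_le continuous_on_objective
        continuous_on_const)
  moreover have "bounded S"
    unfolding S_def using pos by (intro bounded_feasible_sublevel)
  ultimately have "compact S"
    by (simp add: compact_eq_bounded_closed)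
  moreover have "z\<^sub>0 \<in> S"
    using z\<^sub>0 by (simp add: S_def)
  ultimately obtain z where z: "z \<in> S" and min: "\<And>y. y \<in> S \<Longrightarrow> ?obj z \<le> ?obj y"
    using continuous_attains_inf[OF _ _ continuous_on_objective, of S m xs ys \<zeta> \<epsilon>\<^sub>1 \<epsilon>\<^sub>2 \<epsilon>\<^sub>3 \<epsilon>\<^sub>4]
    by blast
  have "\<not> ?obj y < ?obj z" if "?feas y" for y
    using min[of y] z that by (cases "?obj y \<le> ?obj z\<^sub>0") (auto simp: S_def)
  then show ?thesis
    using z unfolding is_arg_min_def S_def by blast
qed

section \<open>Boundedness of the solutions\<close>

lemma poly_basis_combination: "poly_basis d B \<Longrightarrow> (\<lambda>x. u \<bullet> B x) \<in> polys d"
  unfolding poly_basis_def by blast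

lemma poly_basis_differentiable:
  assumes "poly_basis d B"
  shows "B differentiable (at x)"
  unfolding differentiable_componentwise_within[of B]
  using polys_differentiable[OF poly_basis_combination[OF assms]] by (simp add: inner_commute)

lemma poly_field_lipschitz:
  fixes F :: "real ^ 'r ^ 'n" and \<zeta> :: "real ^ 'm \<Rightarrow> real ^ 'r"
  assumes "poly_basis d \<zeta>"
  shows "\<exists>L. L-lipschitz_on (cball 0 R) (\<lambda>x. F *v \<zeta> x)"
proof -
  have "\<exists>L. L-lipschitz_on (cball 0 R) (\<lambda>x. (F *v \<zeta> x) $ i)" for i
    using polys_lipschitz[OF poly_basis_combination[OF assms, of "F $ i"]]
    by (simp add: matrix_mult_dot)
  then obtain L where L: "\<And>i. (L i)-lipschitz_on (cball 0 R) (\<lambda>x. (F *v \<zeta> x) $ i)"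
    by metis
  have "(\<Sum>i\<in>UNIV. L i)-lipschitz_on (cball 0 R) (\<lambda>x. F *v \<zeta> x)"
  proof (rule lipschitz_onI)
    fix x y :: "real ^ 'm" assume x: "x \<in> cball 0 R" and y: "y \<in> cball 0 R"
    have "dist (F *v \<zeta> x) (F *v \<zeta> y) \<le> (\<Sum>i\<in>UNIV. \<bar>(F *v \<zeta> x - F *v \<zeta> y) $ i\<bar>)"
      unfolding dist_norm by (rule norm_le_l1_cart)
    also have "\<dots> \<le> (\<Sum>i\<in>UNIV. L i * dist x y)"
      using lipschitz_onD[OF L x y] by (intro sum_mono) (simp add: dist_real_def)
    finally show "dist (F *v \<zeta> x) (F *v \<zeta> y) \<le> (\<Sum>i\<in>UNIV. L i) * dist x y"
      by (simp add: sum_distrib_right)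
  qed (simp add: sum_nonneg lipschitz_on_nonneg[OF L])
  then show ?thesis ..
qed

lemma bounded_affine_sublevel:
  fixes \<Lambda> :: "real ^ 'n ^ 'n"
  assumes "invertible \<Lambda>"
  shows "bounded {x. (norm (\<Lambda> *v x + \<mu>))\<^sup>2 \<le> M}"
proof -
  obtain A where A: "A ** \<Lambda> = mat 1"
    using assms unfolding invertible_def by blast
  have "{x. (norm (\<Lambda> *v x + \<mu>))\<^sup>2 \<le> M} \<subseteq> (\<lambda>y. A *v (y - \<mu>)) ` cball 0 (sqrt M)"
  proof
    fix x assume "x \<in> {x. (norm (\<Lambda> *v x + \<mu>))\<^sup>2 \<le> M}"
    then have "\<Lambda> *v x + \<mu> \<in> cball 0 (sqrt M)"
      by (simp add: real_le_rsqrt)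
    moreover have "x = A *v (\<Lambda> *v x + \<mu> - \<mu>)"
      by (simp add: matrix_vector_mul_assoc A)
    ultimately show "x \<in> (\<lambda>y. A *v (y - \<mu>)) ` cball 0 (sqrt M)"
      by blast
  qed
  moreover have "bounded ((\<lambda>y. A *v (y - \<mu>)) ` cball 0 (sqrt M))"
    unfolding matrix_vector_mult_def
    by (intro compact_imp_bounded compact_continuous_image compact_cball continuous_intros)
  ultimately show ?thesis
    by (rule bounded_subset[rotated])
qed

text \<open>
  The decay rate is \<open>c / \<alpha>\<close>. It vanishes for \<open>c = 0\<close>, in which case \<open>\<bar>b\<bar> \<le> \<beta> c\<close> forces \<open>b = 0\<close> and
  \<open>V\<close> does not increase along solutions; replacing \<open>b\<close> by \<open>\<beta> c\<close> treats this case together with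
  \<open>c > 0\<close>.
\<close>

lemma feasible_bounded_solutions:
  fixes \<phi> :: "real ^ 'n \<Rightarrow> real ^ 'p" and \<zeta> :: "real ^ 'n \<Rightarrow> real ^ 'r"
  assumes \<phi>: "poly_basis d\<^sub>v \<phi>" and \<zeta>: "poly_basis d\<^sub>f \<zeta>"
    and \<Lambda>: "invertible \<Lambda>" and \<alpha>: "\<alpha> > 0"
    and feas: "feasible d\<^sub>v d\<^sub>f \<phi> \<zeta> \<Lambda> \<mu> \<alpha> \<beta> (F, u, b, c)"
  shows "has_bounded_solutions (\<lambda>x. F *v \<zeta> x)"
proof -
  define V where "V x = u \<bullet> \<phi> x" for x
  define DV where "DV x h = u \<bullet> frechet_derivative \<phi> (at x) h" for x h
  have D\<phi>: "(\<phi> has_derivative frechet_derivative \<phi> (at x)) (at x)" for x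
    using poly_basis_differentiable[OF \<phi>] frechet_derivative_works by blast
  have c: "0 \<le> c" and b: "b \<le> \<beta> * c"
    using feas by (auto simp: feasible_def)
  \<comment> \<open>the inner product in the first constraint is the derivative of \<open>V\<close> along the field\<close>
  have chain: "(F *v \<zeta> x) \<bullet> (transpose (jacobian \<phi> x) *v u) = DV x (F *v \<zeta> x)" for x
  proof -
    have "(F *v \<zeta> x) \<bullet> (transpose (jacobian \<phi> x) *v u) = u \<bullet> (jacobian \<phi> x *v (F *v \<zeta> x))"
      by (metis dot_lmul_matrix inner_commute transpose_matrix_vector)
    then show ?thesis
      by (simp add: DV_def jacobian_def matrix_works linear_matrix_vector_mul_eq
          has_derivative_linear[OF D\<phi>])
  qed
  show ?thesis
  proof (rule lyapunov_bounded_solutions)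
    show "\<exists>L. L-lipschitz_on (cball 0 R) (\<lambda>x. F *v \<zeta> x)" for R
      using \<zeta> by (rule poly_field_lipschitz)
    show "(V has_derivative DV x) (at x)" for x
      unfolding V_def[abs_def] DV_def[abs_def] by (intro has_derivative_inner_right D\<phi>)
    show "DV x (F *v \<zeta> x) \<le> c / \<alpha> * (\<beta> - V x)" for x
    proof -
      have "(\<lambda>x. b - c * V x - \<alpha> * DV x (F *v \<zeta> x)) \<in> sos (d\<^sub>v + d\<^sub>f - 1)"
        using feas unfolding feasible_def prod.case chain V_def by blast
      from sos_nonneg[OF this, of x] b have "\<alpha> * DV x (F *v \<zeta> x) \<le> c * (\<beta> - V x)"
        by (simp add: algebra_simps)
      then show ?thesis
        using \<alpha> by (simp add: field_simps)
    qed
    show "0 \<le> c / \<alpha>"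
      using c \<alpha> by simp
    show "bounded {x. V x \<le> M}" for M
    proof (rule bounded_subset[OF bounded_affine_sublevel[OF \<Lambda>]])
      have "(\<lambda>x. V x - (norm (\<Lambda> *v x + \<mu>))\<^sup>2) \<in> sos d\<^sub>v"
        using feas by (simp add: feasible_def V_def)
      then have "(norm (\<Lambda> *v x + \<mu>))\<^sup>2 \<le> V x" for x
        using sos_nonneg[of "\<lambda>x. V x - (norm (\<Lambda> *v x + \<mu>))\<^sup>2"] by force
      then show "{x. V x \<le> M} \<subseteq> {x. (norm (\<Lambda> *v x + \<mu>))\<^sup>2 \<le> M}"
        using order_trans by blast
    qed
  qed
qed

theorem theorem2p3:
  fixes m d\<^sub>f d\<^sub>v :: nat
    and xs ys :: "nat \<Rightarrow> real ^ 'n"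
    and \<phi> :: "real ^ 'n \<Rightarrow> real ^ 'p"
    and \<zeta> :: "real ^ 'n \<Rightarrow> real ^ 'r"
    and \<Lambda> :: "real ^ 'n ^ 'n" and \<mu> :: "real ^ 'n"
    and \<alpha> \<beta> \<epsilon>\<^sub>1 \<epsilon>\<^sub>2 \<epsilon>\<^sub>3 \<epsilon>\<^sub>4 :: real
  assumes "m \<ge> 1" and "d\<^sub>f \<ge> 1" and "d\<^sub>v \<ge> 2"
    and "CARD('p) = (CARD('n) + d\<^sub>v) choose CARD('n)"
    and "CARD('r) = (CARD('n) + d\<^sub>f) choose CARD('n)"
    and "poly_basis d\<^sub>v \<phi>" and "poly_basis d\<^sub>f \<zeta>"
    and "invertible \<Lambda>"
    and "\<alpha> > 0" and "\<beta> > 0"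
    and "\<epsilon>\<^sub>1 > 0" and "\<epsilon>\<^sub>2 > 0" and "\<epsilon>\<^sub>3 > 0" and "\<epsilon>\<^sub>4 > 0"
  shows "(\<exists>z. feasible d\<^sub>v d\<^sub>f \<phi> \<zeta> \<Lambda> \<mu> \<alpha> \<beta> z) \<and>
    (\<exists>z. is_arg_min (objective m xs ys \<zeta> \<epsilon>\<^sub>1 \<epsilon>\<^sub>2 \<epsilon>\<^sub>3 \<epsilon>\<^sub>4) (feasible d\<^sub>v d\<^sub>f \<phi> \<zeta> \<Lambda> \<mu> \<alpha> \<beta>) z) \<and>
    (\<forall>F. (\<exists>u b c. feasible d\<^sub>v d\<^sub>f \<phi> \<zeta> \<Lambda> \<mu> \<alpha> \<beta> (F, u, b, c)) \<longrightarrow>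
       has_bounded_solutions (\<lambda>x. F *v \<zeta> x))"
proof (intro conjI allI impI)
  show "\<exists>z. feasible d\<^sub>v d\<^sub>f \<phi> \<zeta> \<Lambda> \<mu> \<alpha> \<beta> z"
    using assms by (intro feasible_exists)
  show "\<exists>z. is_arg_min (objective m xs ys \<zeta> \<epsilon>\<^sub>1 \<epsilon>\<^sub>2 \<epsilon>\<^sub>3 \<epsilon>\<^sub>4) (feasible d\<^sub>v d\<^sub>f \<phi> \<zeta> \<Lambda> \<mu> \<alpha> \<beta>) z"
    using assms by (intro minimum_attained)
  fix F :: "real ^ 'r ^ 'n"
  assume "\<exists>u b c. feasible d\<^sub>v d\<^sub>f \<phi> \<zeta> \<Lambda> \<mu> \<alpha> \<beta> (F, u, b, c)"
  then obtain u b c where "feasible d\<^sub>v d\<^sub>f \<phi> \<zeta> \<Lambda> \<mu> \<alpha> \<beta> (F, u, b, c)"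
    by blast
  then show "has_bounded_solutions (\<lambda>x. F *v \<zeta> x)"
    using assms by (intro feasible_bounded_solutions)
qed

end
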